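(* Let $\mathbb{F}$ be a field with $\operatorname{char}(\mathbb{F})\neq 2$. For each of the $3$-dimensional Leibniz algebras $L_i$ over $\mathbb{F}$ with basis $\{e_1,e_2,e_3\}$ listed in the context (with the parameter ranges given there), the Lie-holomorph $\operatorname{hol}_{\mathrm{Lie}}(L_i)$ is as follows, where $\widetilde{e}_j=(e_j,0)$ and $\overline{e_{hk}}=(0,e_{hk})$ for $j,h,k\in\{1,2,3\}$; in each case the displayed elements form a basis and all brackets of basis elements not displayed are zero. (1) $\operatorname{hol}_{\mathrm{Lie}}(L_i)\cong L_i$ for $i=1,8,11$. (2) $\operatorname{hol}_{\mathrm{Lie}}(L_2(\alpha))=\langle \widetilde{e}_1,\widetilde{e}_2,\widetilde{e}_3,\overline{e_{22}},\overline{e_{23}}\rangle$, with non-zero brackets $[\widetilde{e}_1,\widetilde{e}_3]=\alpha\widetilde{e}_1$, $[\widetilde{e}_3,\widetilde{e}_2]=-[\widetilde{e}_2,\widetilde{e}_3]=\widetilde{e}_2$, $[\overline{e_{22}},\overline{e_{23}}]=-[\overline{e_{23}},\overline{e_{22}}]=\overline{e_{23}}$, $[\overline{e_{22}},\widetilde{e}_2]=-[\widetilde{e}_2,\overline{e_{22}}]=[\overline{e_{23}},\widetilde{e}_3]=-[\widetilde{e}_3,\overline{e_{23}}]=\widetilde{e}_2$. (3) $\operatorname{hol}_{\mathrm{Lie}}(L_3)=\langle \widetilde{e}_1,\widetilde{e}_2,\widetilde{e}_3,\overline{e_{13}},\overline{e_{22}},\overline{e_{23}}\rangle$, with non-zero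 brackets $[\widetilde{e}_3,\widetilde{e}_2]=-[\widetilde{e}_2,\widetilde{e}_3]=\widetilde{e}_2$, $[\widetilde{e}_3,\widetilde{e}_3]=\widetilde{e}_1$, $[\overline{e_{22}},\overline{e_{23}}]=-[\overline{e_{23}},\overline{e_{22}}]=\overline{e_{23}}$, $[\overline{e_{13}},\widetilde{e}_3]=-[\widetilde{e}_3,\overline{e_{13}}]=\widetilde{e}_1$, $[\overline{e_{22}},\widetilde{e}_2]=-[\widetilde{e}_2,\overline{e_{22}}]=[\overline{e_{23}},\widetilde{e}_3]=-[\widetilde{e}_3,\overline{e_{23}}]=\widetilde{e}_2$. (4) $\operatorname{hol}_{\mathrm{Lie}}(L_4)=\langle \widetilde{e}_1,\widetilde{e}_2,\widetilde{e}_3,\overline{e_{12}},\overline{e_{13}}\rangle$, with non-zero brackets $[\widetilde{e}_2,\widetilde{e}_2]=[\widetilde{e}_3,\widetilde{e}_3]=\widetilde{e}_1$, $[\overline{e_{12}},\widetilde{e}_2]=-[\widetilde{e}_2,\overline{e_{12}}]=[\overline{e_{13}},\widetilde{e}_3]=-[\widetilde{e}_3,\overline{e_{13}}]=\widetilde{e}_1$. (5) $\operatorname{hol}_{\mathrm{Lie}}(L_5(\alpha))=\langle \widetilde{e}_1,\widetilde{e}_2,\widetilde{e}_3,\overline{e_{12}},\overline{e_{13}}\rangle$, with non-zero brackets $[\widetilde{e}_2,\widetilde{e}_2]=\widetilde{e}_1$, $[\widetilde{e}_3,\widetilde{e}_3]=\alpha\widetilde{e}_1$, $[\overline{e_{12}},\widetilde{e}_2]=-[\widetilde{e}_2,\overline{e_{12}}]=[\overline{e_{13}},\widetilde{e}_3]=-[\widetilde{e}_3,\overline{e_{13}}]=\widetilde{e}_1$.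 (6) If $\alpha\neq\tfrac14$, $\operatorname{hol}_{\mathrm{Lie}}(L_6(\alpha))=\langle \widetilde{e}_1,\widetilde{e}_2,\widetilde{e}_3,\overline{e_{12}},\overline{e_{13}}\rangle$, with non-zero brackets $[\widetilde{e}_2,\widetilde{e}_2]=[\widetilde{e}_2,\widetilde{e}_3]=\widetilde{e}_1$, $[\widetilde{e}_3,\widetilde{e}_3]=\alpha\widetilde{e}_1$, $[\overline{e_{12}},\widetilde{e}_2]=-[\widetilde{e}_2,\overline{e_{12}}]=[\overline{e_{13}},\widetilde{e}_3]=-[\widetilde{e}_3,\overline{e_{13}}]=\widetilde{e}_1$. (7) $\operatorname{hol}_{\mathrm{Lie}}(L_6(\tfrac14))=\langle \widetilde{e}_1,\widetilde{e}_2,\widetilde{e}_3,\overline{e},\overline{e_{12}},\overline{e_{13}}\rangle$, where $\overline{e}=\overline{e_{22}}+\tfrac12\overline{e_{23}}-2\overline{e_{32}}-\overline{e_{33}}$, with non-zero brackets $[\widetilde{e}_2,\widetilde{e}_2]=[\widetilde{e}_2,\widetilde{e}_3]=\widetilde{e}_1$, $[\widetilde{e}_3,\widetilde{e}_3]=\tfrac14\widetilde{e}_1$, $[\overline{e_{12}},\overline{e}]=-[\overline{e},\overline{e_{12}}]=\overline{e_{12}}+\tfrac12\overline{e_{13}}$, $[\overline{e},\overline{e_{13}}]=-[\overline{e_{13}},\overline{e}]=2\overline{e_{12}}+\overline{e_{13}}$, $[\overline{e},\widetilde{e}_2]=-[\widetilde{e}_2,\overline{e}]=2[\overline{e},\widetilde{e}_3]=-[\widetilde{e}_3,\overline{e}]=\widetilde{e}_2-2\widetilde{e}_3$,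 $[\overline{e_{12}},\widetilde{e}_2]=-[\widetilde{e}_2,\overline{e_{12}}]=[\overline{e_{13}},\widetilde{e}_3]=-[\widetilde{e}_3,\overline{e_{13}}]=\widetilde{e}_1$. (8) $\operatorname{hol}_{\mathrm{Lie}}(L_7)=\langle \widetilde{e}_1,\widetilde{e}_2,\widetilde{e}_3,\overline{e_{12}},\overline{e_{13}}\rangle$, with non-zero brackets $[\widetilde{e}_2,\widetilde{e}_3]=[\overline{e_{12}},\widetilde{e}_2]=-[\widetilde{e}_2,\overline{e_{12}}]=[\overline{e_{13}},\widetilde{e}_3]=-[\widetilde{e}_3,\overline{e_{13}}]=\widetilde{e}_1$. (9) $\operatorname{hol}_{\mathrm{Lie}}(L_i(\alpha))\cong L_i(\alpha)$ for $i=9,10$. (10) $\operatorname{hol}_{\mathrm{Lie}}(L_{12})=\langle \widetilde{e}_1,\widetilde{e}_2,\widetilde{e}_3,\overline{e_{23}}\rangle$, with non-zero brackets $[\widetilde{e}_1,\widetilde{e}_3]=\widetilde{e}_2$, $[\widetilde{e}_3,\widetilde{e}_3]=\widetilde{e}_1$, $[\overline{e_{23}},\widetilde{e}_3]=-[\widetilde{e}_3,\overline{e_{23}}]=\widetilde{e}_2$. (11) $\operatorname{hol}_{\mathrm{Lie}}(L_{13})=\langle \widetilde{e}_1,\widetilde{e}_2,\widetilde{e}_3,\overline{e_{23}}\rangle$, with non-zero brackets $[\widetilde{e}_1,\widetilde{e}_3]=\widetilde{e}_1+\widetilde{e}_2$, $[\widetilde{e}_3,\widetilde{e}_3]=\widetilde{e}_1$,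 $[\overline{e_{23}},\widetilde{e}_3]=-[\widetilde{e}_3,\overline{e_{23}}]=\widetilde{e}_2$.
   Context: A (right) Leibniz algebra over $\mathbb{F}$ is a vector space $L$ with a bilinear bracket satisfying $[[x,y],z]=[[x,z],y]+[x,[y,z]]$. A derivation of $L$ is a linear map $d\colon L\to L$ with $d([x,y])=[d(x),y]+[x,d(y)]$; $\operatorname{Der}(L)$ is the Lie algebra of derivations with bracket $[d,d']=d\circ d'-d'\circ d$. The Lie-center is $Z_{\mathrm{Lie}}(L)=\{x\in L\mid [x,y]+[y,x]=0\ \forall y\in L\}$, and $\operatorname{Der}_{\mathrm{Lie}}(L)=\{d\in\operatorname{Der}(L)\mid \operatorname{Im}(d)\subseteq Z_{\mathrm{Lie}}(L)\}$ is the ideal of Lie-derivations. The Lie-holomorph of $L$ is the Leibniz algebra $\operatorname{hol}_{\mathrm{Lie}}(L)=L\rtimes\operatorname{Der}_{\mathrm{Lie}}(L)$, i.e. the vector space $L\times\operatorname{Der}_{\mathrm{Lie}}(L)$ with bracket $$[(x,d),(y,d')]=([x,y]+d(y)-d'(x),\,[d,d']).$$ Linear endomorphisms of a space with basis $\{e_1,e_2,e_3\}$ are identified with $3\times3$ matrices acting on column coordinate vectors; $e_{hk}$ is the elementary matrix with $1$ in entry $(h,k)$ and $0$ elsewhere, so $e_{hk}(e_k)=e_h$ and $e_{hk}(e_j)=0$ for $j\ne k$. (In $\overline{e}$ the notation $\overline{e_{hk}}$ is extended linearly: $\overline{e}=(0,e_{22}+\tfrac12e_{23}-2e_{32}-e_{33})$.)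 $\langle\cdot\rangle$ denotes linear span. The $3$-dimensional non-Lie Leibniz algebras, with basis $\{e_1,e_2,e_3\}$ and only the listed brackets of basis elements non-zero: $L_1$: $[e_1,e_3]=-2e_1$, $[e_2,e_2]=e_1$, $[e_2,e_3]=-[e_3,e_2]=-e_2$. $L_2(\alpha)$, $\alpha\in\mathbb{F}\setminus\{0\}$: $[e_1,e_3]=\alpha e_1$, $[e_2,e_3]=-[e_3,e_2]=-e_2$. $L_3$: $[e_2,e_3]=-[e_3,e_2]=-e_2$, $[e_3,e_3]=e_1$. $L_4$: $[e_2,e_2]=[e_3,e_3]=e_1$. $L_5(\alpha)$: $[e_2,e_2]=e_1$, $[e_3,e_3]=\alpha e_1$, where $\alpha$ is a representative of a non-trivial class of $\mathbb{F}^\times/(\mathbb{F}^\times)^2$. $L_6(\alpha)$, $\alpha\in\mathbb{F}\setminus\{0\}$: $[e_2,e_2]=[e_2,e_3]=e_1$, $[e_3,e_3]=\alpha e_1$. $L_7$: $[e_2,e_3]=e_1$. $L_8$: $[e_1,e_3]=e_2$, $[e_2,e_3]=e_1$. $L_9(\alpha)$: $[e_1,e_3]=e_2$, $[e_2,e_3]=\alpha e_1$, where $\alpha$ is a representative of a non-trivial class of $\mathbb{F}^\times/(\mathbb{F}^\times)^2$. $L_{10}(\alpha)$, $\alpha\in\mathbb{F}\setminus\{0\}$: $[e_1,e_3]=e_2$, $[e_2,e_3]=\alpha e_1+e_2$. $L_{11}$: $[e_1,e_3]=e_1$, $[e_2,e_3]=e_2$. $L_{12}$: $[e_1,e_3]=e_2$,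 $[e_3,e_3]=e_1$. $L_{13}$: $[e_1,e_3]=e_1+e_2$, $[e_3,e_3]=e_1$.
   Formalization: In item (7) the printed equality −[ẽ₃,ē] = ẽ₂−2ẽ₃ is false (the bracket gives ½(ẽ₂−2ẽ₃)); it is corrected to −2[ẽ₃,ē] = ẽ₂−2ẽ₃, i.e. [ẽ₃,ē] = −½(ẽ₂−2ẽ₃). *)

theory Defs
  imports "HOL-Analysis.Analysis" "HOL-Library.Function_Algebras"
begin

section \<open>Leibniz algebras, derivations, Lie-center\<close>

text \<open>A vector space over \<open>'f\<close> with a product, sitting on a subset of an additive group
  \<open>'v\<close>. A carrier set is needed because the Lie-holomorph lives on \<open>L \<times> Der\<^sub>L\<^sub>i\<^sub>e(L)\<close>, where the
  second factor is a set of functions.\<close>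

record ('f, 'v) alg =
  carr :: "'v set"
  scl :: "'f \<Rightarrow> 'v \<Rightarrow> 'v"
  brk :: "'v \<Rightarrow> 'v \<Rightarrow> 'v"

locale leibniz_algebra = vector_space "scl A"
  for A :: "('f::field, 'v::ab_group_add) alg" +
  assumes carr_subspace: "subspace (carr A)"
    and brk_closed: "\<lbrakk>x \<in> carr A; y \<in> carr A\<rbrakk> \<Longrightarrow> brk A x y \<in> carr A"
    and brk_add_left: "\<lbrakk>x \<in> carr A; y \<in> carr A; z \<in> carr A\<rbrakk>
      \<Longrightarrow> brk A (x + y) z = brk A x z + brk A y z"
    and brk_add_right: "\<lbrakk>x \<in> carr A; y \<in> carr A; z \<in> carr A\<rbrakk>
      \<Longrightarrow> brk A x (y + z) = brk A x y + brk A x z"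
    and brk_scl_left: "\<lbrakk>x \<in> carr A; y \<in> carr A\<rbrakk> \<Longrightarrow> brk A (scl A c x) y = scl A c (brk A x y)"
    and brk_scl_right: "\<lbrakk>x \<in> carr A; y \<in> carr A\<rbrakk> \<Longrightarrow> brk A x (scl A c y) = scl A c (brk A x y)"
    and leibniz: "\<lbrakk>x \<in> carr A; y \<in> carr A; z \<in> carr A\<rbrakk>
      \<Longrightarrow> brk A (brk A x y) z = brk A (brk A x z) y + brk A x (brk A y z)"

definition linear_map ::
  "('f, 'v::ab_group_add) alg \<Rightarrow> ('f, 'w::ab_group_add) alg \<Rightarrow> ('v \<Rightarrow> 'w) \<Rightarrow> bool" where
  "linear_map A B f \<longleftrightarrow> f ` carr A \<subseteq> carr B
    \<and> (\<forall>x\<in>carr A. \<forall>y\<in>carr A. f (x + y) = f x + f y)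
    \<and> (\<forall>c. \<forall>x\<in>carr A. f (scl A c x) = scl B c (f x))"

text \<open>A map on the carrier is represented by the function that vanishes off the carrier, so that
  equality of derivations is equality of functions. The clause is void if the carrier is the
  whole type, as it is for the algebras \<open>L\<^sub>i\<close> below.\<close>

definition Der :: "('f, 'v::ab_group_add) alg \<Rightarrow> ('v \<Rightarrow> 'v) set" where
  "Der A = {d. linear_map A A d
    \<and> (\<forall>x\<in>carr A. \<forall>y\<in>carr A. d (brk A x y) = brk A (d x) y + brk A x (d y))
    \<and> (\<forall>x. x \<notin> carr A \<longrightarrow> d x = 0)}"

definition Z_Lie :: "('f, 'v::ab_group_add) alg \<Rightarrow> 'v set" where
  "Z_Lie A = {x \<in> carr A. \<forall>y\<in>carr A. brk A x y + brk A y x = 0}"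

definition Der_Lie :: "('f, 'v::ab_group_add) alg \<Rightarrow> ('v \<Rightarrow> 'v) set" where
  "Der_Lie A = {d \<in> Der A. d ` carr A \<subseteq> Z_Lie A}"

definition hol_Lie :: "('f, 'v::ab_group_add) alg \<Rightarrow> ('f, 'v \<times> ('v \<Rightarrow> 'v)) alg" where
  "hol_Lie A = \<lparr>
     carr = carr A \<times> Der_Lie A,
     scl = (\<lambda>c (x, d). (scl A c x, \<lambda>v. scl A c (d v))),
     brk = (\<lambda>(x, d) (y, d'). (brk A x y + d y - d' x, (d \<circ> d') - (d' \<circ> d))) \<rparr>"

definition isomorphic_alg ::
  "('f, 'v::ab_group_add) alg \<Rightarrow> ('f, 'w::ab_group_add) alg \<Rightarrow> bool" (infix \<open>\<cong>\<^sub>L\<close> 50) where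
  "A \<cong>\<^sub>L B \<longleftrightarrow> (\<exists>f. linear_map A B f \<and> bij_betw f (carr A) (carr B)
    \<and> (\<forall>x\<in>carr A. \<forall>y\<in>carr A. f (brk A x y) = brk B (f x) (f y)))"

text \<open>\<open>has_basis_brackets A bs T\<close>: the members of \<open>bs\<close> are pairwise distinct and form a basis of
  \<open>A\<close>; for each triple \<open>(u, v, w)\<close> in \<open>T\<close>, \<open>u\<close> and \<open>v\<close> are basis elements with
  \<open>[u, v] = w \<noteq> 0\<close>; and \<open>[u, v] = 0\<close> for all pairs of basis elements not listed in \<open>T\<close>.\<close>

definition has_basis_brackets ::
  "('f::field, 'v::ab_group_add) alg \<Rightarrow> 'v list \<Rightarrow> ('v \<times> 'v \<times> 'v) set \<Rightarrow> bool" where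
  "has_basis_brackets A bs T \<longleftrightarrow>
     distinct bs \<and> \<not> module.dependent (scl A) (set bs) \<and> module.span (scl A) (set bs) = carr A
   \<and> (\<forall>(u, v, w) \<in> T. u \<in> set bs \<and> v \<in> set bs \<and> brk A u v = w \<and> w \<noteq> 0)
   \<and> (\<forall>u\<in>set bs. \<forall>v\<in>set bs. (\<nexists>w. (u, v, w) \<in> T) \<longrightarrow> brk A u v = 0)"


section \<open>The three-dimensional non-Lie Leibniz algebras\<close>

definition e :: "3 \<Rightarrow> 'a::field ^ 3" where
  "e i = axis i 1"

text \<open>\<open>alg3 T\<close> is \<open>F\<^sup>3\<close> with the bilinear product determined by \<open>[e\<^sub>i, e\<^sub>j] = w\<close> for the entries
  \<open>(i, j, w)\<close> of \<open>T\<close> and \<open>[e\<^sub>i, e\<^sub>j] = 0\<close> for all other \<open>i, j\<close>. The index \<open>3 :: 3\<close> is a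
  legitimate index: the type \<open>3\<close> consists of \<open>1\<close>, \<open>2\<close> and \<open>3 = 0\<close>.\<close>

definition alg3 :: "(3 \<times> 3 \<times> ('a::field ^ 3)) list \<Rightarrow> ('a, 'a ^ 3) alg" where
  "alg3 T = \<lparr> carr = UNIV, scl = (*s),
     brk = (\<lambda>x y. \<Sum>(i, j, w)\<leftarrow>T. (x $ i * y $ j) *s w) \<rparr>"

definition L1 :: "('a::field, 'a ^ 3) alg" where
  "L1 = alg3 [(1, 3, (-2) *s e 1), (2, 2, e 1), (2, 3, - e 2), (3, 2, e 2)]"

definition L2 :: "'a \<Rightarrow> ('a::field, 'a ^ 3) alg" where
  "L2 \<alpha> = alg3 [(1, 3, \<alpha> *s e 1), (2, 3, - e 2), (3, 2, e 2)]"

definition L3 :: "('a::field, 'a ^ 3) alg" where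
  "L3 = alg3 [(2, 3, - e 2), (3, 2, e 2), (3, 3, e 1)]"

definition L4 :: "('a::field, 'a ^ 3) alg" where
  "L4 = alg3 [(2, 2, e 1), (3, 3, e 1)]"

definition L5 :: "'a \<Rightarrow> ('a::field, 'a ^ 3) alg" where
  "L5 \<alpha> = alg3 [(2, 2, e 1), (3, 3, \<alpha> *s e 1)]"

definition L6 :: "'a \<Rightarrow> ('a::field, 'a ^ 3) alg" where
  "L6 \<alpha> = alg3 [(2, 2, e 1), (2, 3, e 1), (3, 3, \<alpha> *s e 1)]"

definition L7 :: "('a::field, 'a ^ 3) alg" where
  "L7 = alg3 [(2, 3, e 1)]"

definition L8 :: "('a::field, 'a ^ 3) alg" where
  "L8 = alg3 [(1, 3, e 2), (2, 3, e 1)]"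

definition L9 :: "'a \<Rightarrow> ('a::field, 'a ^ 3) alg" where
  "L9 \<alpha> = alg3 [(1, 3, e 2), (2, 3, \<alpha> *s e 1)]"

definition L10 :: "'a \<Rightarrow> ('a::field, 'a ^ 3) alg" where
  "L10 \<alpha> = alg3 [(1, 3, e 2), (2, 3, \<alpha> *s e 1 + e 2)]"

definition L11 :: "('a::field, 'a ^ 3) alg" where
  "L11 = alg3 [(1, 3, e 1), (2, 3, e 2)]"

definition L12 :: "('a::field, 'a ^ 3) alg" where
  "L12 = alg3 [(1, 3, e 2), (3, 3, e 1)]"

definition L13 :: "('a::field, 'a ^ 3) alg" where
  "L13 = alg3 [(1, 3, e 1 + e 2), (3, 3, e 1)]"

text \<open>Representatives \<open>\<alpha>\<close> of the non-trivial classes of \<open>F\<^sup>\<times>/(F\<^sup>\<times>)\<^sup>2\<close>.\<close>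

definition nontrivial_square_class :: "'a::field \<Rightarrow> bool" where
  "nontrivial_square_class \<alpha> \<longleftrightarrow> \<alpha> \<noteq> 0 \<and> (\<nexists>\<beta>. \<beta> \<noteq> 0 \<and> \<alpha> = \<beta>\<^sup>2)"


section \<open>Elements of the holomorphs\<close>

definition elem_mat :: "3 \<Rightarrow> 3 \<Rightarrow> 'a::field ^ 3 ^ 3" where
  "elem_mat h k = (\<chi> i j. if i = h \<and> j = k then 1 else 0)"

definition etil :: "3 \<Rightarrow> ('a::field ^ 3) \<times> ('a ^ 3 \<Rightarrow> 'a ^ 3)" where
  "etil j = (e j, 0)"

definition ebar :: "3 \<Rightarrow> 3 \<Rightarrow> ('a::field ^ 3) \<times> ('a ^ 3 \<Rightarrow> 'a ^ 3)" where
  "ebar h k = (0, \<lambda>v. elem_mat h k *v v)"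

text \<open>The scalar multiplication of the holomorphs of the \<open>L\<^sub>i\<close>
  (see \<open>scl_hol_Lie_alg3\<close>), independent of the bracket of \<open>L\<^sub>i\<close>.\<close>

definition scl_hol ::
  "'a::field \<Rightarrow> ('a ^ 3) \<times> ('a ^ 3 \<Rightarrow> 'a ^ 3) \<Rightarrow> ('a ^ 3) \<times> ('a ^ 3 \<Rightarrow> 'a ^ 3)" (infixr \<open>\<odot>\<close> 75) where
  "c \<odot> p = (c *s fst p, \<lambda>v. c *s snd p v)"

definition ebar0 :: "('a::field ^ 3) \<times> ('a ^ 3 \<Rightarrow> 'a ^ 3)" where
  "ebar0 = ebar 2 2 + (1/2) \<odot> ebar 2 3 - 2 \<odot> ebar 3 2 - ebar 3 3"


section \<open>The definitions describe Leibniz algebras\<close>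

lemma scl_hol_Lie_alg3: "scl (hol_Lie (alg3 T)) = (\<odot>)"
  by (auto simp: hol_Lie_def alg3_def scl_hol_def fun_eq_iff)

lemma alg3_sel [simp]:
  "carr (alg3 T) = UNIV" "scl (alg3 T) = (*s)"
  "brk (alg3 T) x y = (\<Sum>(i, j, w)\<leftarrow>T. (x $ i * y $ j) *s w)"
  by (simp_all add: alg3_def)

lemma leibniz_algebra_alg3:
  assumes "\<And>x y z. brk (alg3 T) (brk (alg3 T) x y) z =
    brk (alg3 T) (brk (alg3 T) x z) y + brk (alg3 T) x (brk (alg3 T) y z)"
  shows "leibniz_algebra (alg3 T)"
proof -
  have 1: "brk (alg3 T) (x + y) z = brk (alg3 T) x z + brk (alg3 T) y z" for x y z
    by (induction T) (auto simp: algebra_simps)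
  have 2: "brk (alg3 T) x (y + z) = brk (alg3 T) x y + brk (alg3 T) x z" for x y z
    by (induction T) (auto simp: algebra_simps)
  have 3: "brk (alg3 T) (c *s x) y = c *s brk (alg3 T) x y" for x y c
    by (induction T) (auto simp: algebra_simps)
  have 4: "brk (alg3 T) x (c *s y) = c *s brk (alg3 T) x y" for x y c
    by (induction T) (auto simp: algebra_simps)
  interpret vector_space "scl (alg3 T)"
    by (simp add: vec.vector_space_axioms)
  show ?thesis
    by unfold_locales (simp add: subspace_def, simp, simp only: 1, simp only: 2,
      simp only: 3 alg3_sel(2), simp only: 4 alg3_sel(2), rule assms)
qed

lemma leibniz_algebra_L:
  "leibniz_algebra L1" "leibniz_algebra (L2 \<alpha>)" "leibniz_algebra L3" "leibniz_algebra L4"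
  "leibniz_algebra (L5 \<alpha>)" "leibniz_algebra (L6 \<alpha>)" "leibniz_algebra L7" "leibniz_algebra L8"
  "leibniz_algebra (L9 \<alpha>)" "leibniz_algebra (L10 \<alpha>)" "leibniz_algebra L11"
  "leibniz_algebra L12" "leibniz_algebra L13"
  unfolding L1_def L2_def L3_def L4_def L5_def L6_def L7_def L8_def L9_def L10_def L11_def
    L12_def L13_def
  by (rule leibniz_algebra_alg3; simp add: vec_eq_iff forall_3 e_def axis_def; 
      simp add: algebra_simps)+

lemma (in leibniz_algebra) leibniz_algebra_hol_Lie: "leibniz_algebra (hol_Lie A)"
proof -
  let ?c = "carr A" and ?s = "scl A"
  have c0: "0 \<in> ?c" and cadd: "\<And>x y. x \<in> ?c \<Longrightarrow> y \<in> ?c \<Longrightarrow> x + y \<in> ?c"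
    and cs: "\<And>x a. x \<in> ?c \<Longrightarrow> ?s a x \<in> ?c"
    and cdiff: "\<And>x y. x \<in> ?c \<Longrightarrow> y \<in> ?c \<Longrightarrow> x - y \<in> ?c"
    using carr_subspace by (auto simp: subspace_0 subspace_add subspace_scale subspace_diff)
  have b0l: "brk A 0 y = 0" and b0r: "brk A y 0 = 0" if "y \<in> ?c" for y
    using brk_scl_left[OF that that, of 0] brk_scl_right[OF that that, of 0] by auto
  have bdl: "brk A (x - y) z = brk A x z - brk A y z"
    and bdr: "brk A z (x - y) = brk A z x - brk A z y"
    if "x \<in> ?c" "y \<in> ?c" "z \<in> ?c" for x y z
    using brk_add_left[of "x - y" y z] brk_add_right[of z "x - y" y] that cdiff
    by (auto simp: algebra_simps)
  have DL: "d \<in> Der_Lie A \<longleftrightarrow> (\<forall>x\<in>?c. d x \<in> ?c)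
      \<and> (\<forall>x\<in>?c. \<forall>y\<in>?c. d (x + y) = d x + d y) \<and> (\<forall>a. \<forall>x\<in>?c. d (?s a x) = ?s a (d x))
      \<and> (\<forall>x\<in>?c. \<forall>y\<in>?c. d (brk A x y) = brk A (d x) y + brk A x (d y))
      \<and> (\<forall>x. x \<notin> ?c \<longrightarrow> d x = 0)
      \<and> (\<forall>x\<in>?c. \<forall>y\<in>?c. brk A (d x) y = - brk A y (d x))" for d
    by (auto simp: Der_Lie_def Der_def linear_map_def Z_Lie_def image_subset_iff
        eq_neg_iff_add_eq_0)
  have d0: "d 0 = 0" if "d \<in> Der_Lie A" for d
  proof -
    have "d (?s 0 0) = ?s 0 (d 0)" using that c0 unfolding DL by blast
    then show ?thesis by simp
  qed
  have dd: "d (x - y) = d x - d y" if "d \<in> Der_Lie A" "x \<in> ?c" "y \<in> ?c" for d x y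
  proof -
    have "d (x - y + y) = d (x - y) + d y" using that cdiff unfolding DL by blast
    then show ?thesis by (simp add: algebra_simps)
  qed
  have D0: "0 \<in> Der_Lie A"
    unfolding DL using c0 by (auto simp: b0l b0r)
  have Dadd: "d + d' \<in> Der_Lie A" if "d \<in> Der_Lie A" "d' \<in> Der_Lie A" for d d'
    using that unfolding DL
    by (auto simp: cadd brk_add_left brk_add_right scale_right_distrib algebra_simps)
  have Ds: "(\<lambda>v. ?s a (d v)) \<in> Der_Lie A" if "d \<in> Der_Lie A" for d a
    using that unfolding DL
    by (auto simp: cs brk_scl_left brk_scl_right scale_right_distrib scale_right_diff_distrib
        scale_left_commute)
  have Dadd': "d (x + y) = d x + d y" if "d \<in> Der_Lie A" "x \<in> ?c" "y \<in> ?c" for d x y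
    using that unfolding DL by blast
  have Dscl': "d (?s a x) = ?s a (d x)" if "d \<in> Der_Lie A" "x \<in> ?c" for d x a
    using that unfolding DL by blast
  have D_off: "d x = 0" if "d \<in> Der_Lie A" "x \<notin> ?c" for d x
    using that unfolding DL by blast
  have Dcl: "d x \<in> ?c" if "d \<in> Der_Lie A" for d x
    using that c0 unfolding DL by (cases "x \<in> ?c") auto
  have Dbrk: "d (brk A x y) = brk A (d x) y + brk A x (d y)"
    if "d \<in> Der_Lie A" "x \<in> ?c" "y \<in> ?c" for d x y
    using that unfolding DL by blast
  have Dz: "brk A (d x) y = - brk A y (d x)" if "d \<in> Der_Lie A" "x \<in> ?c" "y \<in> ?c" for d x y
    using that unfolding DL by blast
  have Dc: "(d \<circ> d') - (d' \<circ> d) \<in> Der_Lie A" if D: "d \<in> Der_Lie A" "d' \<in> Der_Lie A" for d d'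
    unfolding DL
  proof (intro conjI ballI allI impI)
    fix x y assume m: "x \<in> ?c" "y \<in> ?c"
    show "((d \<circ> d') - (d' \<circ> d)) (brk A x y) =
        brk A (((d \<circ> d') - (d' \<circ> d)) x) y + brk A x (((d \<circ> d') - (d' \<circ> d)) y)"
      using m D by (simp add: Dbrk Dcl brk_closed Dadd' bdl bdr d0 b0l b0r)
    show "brk A (((d \<circ> d') - (d' \<circ> d)) x) y = - brk A y (((d \<circ> d') - (d' \<circ> d)) x)"
      using m D Dz[OF D(1) Dcl[OF D(2)] m(2)] Dz[OF D(2) Dcl[OF D(1)] m(2)]
      by (simp add: Dcl bdl bdr)
  qed (use D in \<open>simp_all add: Dcl cdiff cadd cs Dadd' Dscl' D_off d0 scale_right_diff_distrib\<close>)
  have sel: "carr (hol_Lie A) = ?c \<times> Der_Lie A"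
    "\<And>a p. scl (hol_Lie A) a p = (?s a (fst p), \<lambda>v. ?s a (snd p v))"
    "\<And>x d y d'. brk (hol_Lie A) (x, d) (y, d') = (brk A x y + d y - d' x, (d \<circ> d') - (d' \<circ> d))"
    by (auto simp: hol_Lie_def split: prod.splits)
  have vs: "vector_space (scl (hol_Lie A))"
    by unfold_locales
      (auto simp: sel scale_right_distrib scale_left_distrib prod_eq_iff fun_eq_iff)
  show ?thesis
  proof (intro leibniz_algebra.intro leibniz_algebra_axioms.intro)
    show "vector_space (scl (hol_Lie A))" by fact
    interpret h: vector_space "scl (hol_Lie A)" by fact
    show "module.subspace (scl (hol_Lie A)) (carr (hol_Lie A))"
      unfolding h.subspace_def using c0 cadd cs D0 Dadd Ds
      by (auto simp: sel zero_prod_def)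
  next
    fix p q assume "p \<in> carr (hol_Lie A)" "q \<in> carr (hol_Lie A)"
    then show "brk (hol_Lie A) p q \<in> carr (hol_Lie A)"
      using Dc by (auto simp: sel cadd cdiff brk_closed Dcl)
  next
    fix p q r assume a: "p \<in> carr (hol_Lie A)" "q \<in> carr (hol_Lie A)" "r \<in> carr (hol_Lie A)"
    obtain x d y d' z d'' where p: "p = (x, d)" and q: "q = (y, d')" and r: "r = (z, d'')"
      by (metis surj_pair)
    have m: "x \<in> ?c" "y \<in> ?c" "z \<in> ?c" "d \<in> Der_Lie A" "d' \<in> Der_Lie A" "d'' \<in> Der_Lie A"
      using a by (auto simp: sel p q r)
    show "brk (hol_Lie A) (p + q) r = brk (hol_Lie A) p r + brk (hol_Lie A) q r"
      using m by (auto simp: sel p q r brk_add_left Dadd' Dcl fun_eq_iff algebra_simps)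
    show "brk (hol_Lie A) p (q + r) = brk (hol_Lie A) p q + brk (hol_Lie A) p r"
      using m by (auto simp: sel p q r brk_add_right Dadd' Dcl fun_eq_iff algebra_simps)
    show "brk (hol_Lie A) (brk (hol_Lie A) p q) r =
        brk (hol_Lie A) (brk (hol_Lie A) p r) q + brk (hol_Lie A) p (brk (hol_Lie A) q r)"
      unfolding p q r sel add_Pair prod.inject
    proof (intro conjI)
      show "brk A (brk A x y + d y - d' x) z + ((d \<circ> d') - (d' \<circ> d)) z - d'' (brk A x y + d y - d' x) =
          brk A (brk A x z + d z - d'' x) y + ((d \<circ> d'') - (d'' \<circ> d)) y - d' (brk A x z + d z - d'' x) +
          (brk A x (brk A y z + d' z - d'' y) + d (brk A y z + d' z - d'' y)
            - ((d' \<circ> d'') - (d'' \<circ> d')) x)"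
        using m leibniz[of x y z] Dz[OF m(4) m(2) m(3)] Dz[OF m(4) m(3) m(2)]
          Dz[OF m(5) m(3) m(1)] Dz[OF m(5) m(1) m(3)] Dz[OF m(6) m(1) m(2)] Dz[OF m(6) m(2) m(1)]
        by (simp add: Dcl cadd cdiff brk_closed brk_add_left brk_add_right bdl bdr Dadd' dd Dbrk)
      show "(((d \<circ> d') - (d' \<circ> d)) \<circ> d'') - (d'' \<circ> ((d \<circ> d') - (d' \<circ> d))) =
          ((((d \<circ> d'') - (d'' \<circ> d)) \<circ> d') - (d' \<circ> ((d \<circ> d'') - (d'' \<circ> d)))) +
          ((d \<circ> ((d' \<circ> d'') - (d'' \<circ> d'))) - (((d' \<circ> d'') - (d'' \<circ> d')) \<circ> d))"
        using m by (intro ext) (auto simp: dd Dcl algebra_simps)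
    qed
  next
    fix p q a assume a: "p \<in> carr (hol_Lie A)" "q \<in> carr (hol_Lie A)"
    obtain x d y d' where p: "p = (x, d)" and q: "q = (y, d')"
      by (metis surj_pair)
    have m: "x \<in> ?c" "y \<in> ?c" "d \<in> Der_Lie A" "d' \<in> Der_Lie A"
      using a by (auto simp: sel p q)
    show "brk (hol_Lie A) (scl (hol_Lie A) a p) q = scl (hol_Lie A) a (brk (hol_Lie A) p q)"
      using m by (auto simp: sel p q brk_scl_left Dscl' Dcl fun_eq_iff
          scale_right_distrib scale_right_diff_distrib)
    show "brk (hol_Lie A) p (scl (hol_Lie A) a q) = scl (hol_Lie A) a (brk (hol_Lie A) p q)"
      using m by (auto simp: sel p q brk_scl_right Dscl' Dcl fun_eq_iff
          scale_right_distrib scale_right_diff_distrib)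
  qed
qed

end

theory Submission
  imports Defs
begin

text \<open>
  A Lie-derivation \<open>d\<close> has values in the Lie-center, so \<open>d [x, x] = [d x, x] + [x, d x] = 0\<close>:
  it kills all squares \<open>[x, x]\<close>, hence by polarisation all \<open>[x, y] + [y, x]\<close>. In characteristic
  other than 2 both constraints are strong in dimension three. The Lie-center is the radical of the
  symmetrised bracket, a small subspace that is read off from the structure constants, and the span
  of the squares is a line or a plane on which \<open>d\<close> vanishes. What remains of the derivation
  condition are a few linear equations for the matrix of \<open>d\<close>.

  For \<open>L1\<close>, \<open>L8\<close>, \<open>L9 \<alpha>\<close>, \<open>L10 \<alpha>\<close> and \<open>L11\<close> the radical is zero; then there is no
  non-zero Lie-derivation and the first projection is an isomorphism from the holomorph to the algebra
  (\<open>hol_Lie_iso_if_Z_Lie_trivial\<close>). For the other algebras except \<open>L6 (1/4)\<close> the solutions are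
  all matrices whose non-zero entries lie in a certain set of positions (\<open>supported_on\<close>), so
  that the matrix units at these positions complete the \<open>etil j\<close> to a basis of the holomorph
  (\<open>hol_Lie_alg3_supported_basis\<close>), and the brackets follow from the products of matrix units.

  The algebra \<open>L6 \<alpha>\<close> changes behaviour at \<open>\<alpha> = 1/4\<close> because the symmetrised form
  \<open>2 x\<^sub>2 y\<^sub>2 + x\<^sub>2 y\<^sub>3 + x\<^sub>3 y\<^sub>2 + 2 \<alpha> x\<^sub>3 y\<^sub>3\<close> has determinant \<open>4 \<alpha> - 1\<close> on the
  plane of \<open>e 2\<close> and \<open>e 3\<close>. At \<open>1/4\<close> the vector \<open>e 2 - 2 e 3\<close> joins the
  radical, and the space of Lie-derivations acquires one further dimension, spanned by the rank one
  map \<open>ebar0\<close>, which is not a matrix unit (\<open>Der_Lie_L6_quarter_iff\<close>).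
\<close>

section \<open>Coordinates\<close>

lemma e_nth: "e i $ j = (if j = i then 1 else 0)"
  by (simp add: e_def axis_def)

lemma e_eq_iff: "e i = e j \<longleftrightarrow> i = j" and e_neq_0: "e i \<noteq> 0"
  by (auto simp: vec_eq_iff e_nth)

lemma elem_mat_mult_vec: "elem_mat h k *v v = (v $ k) *s e h"
  by (simp add: elem_mat_def matrix_vector_mult_def e_nth vec_eq_iff
      if_distrib[where f="\<lambda>x. x * _"] cong: if_cong)

lemma ebar_eq: "ebar h k = (0, \<lambda>v. (v $ k) *s e h)"
  by (simp add: ebar_def elem_mat_mult_vec)

lemma vec3_expand: "(v :: 'a::field ^ 3) = v $ 1 *s e 1 + v $ 2 *s e 2 + v $ 3 *s e 3"
  by (simp add: vec_eq_iff forall_3 e_nth)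

lemma basis_induct3:
  fixes x :: "'a::field ^ 3"
  assumes "\<And>j. P (e j)" "\<And>x y. P x \<Longrightarrow> P y \<Longrightarrow> P (x + y)" "\<And>c x. P x \<Longrightarrow> P (c *s x)"
  shows "P x"
  by (subst vec3_expand) (intro assms)

lemma four_neq_0: "(2::'a::field) \<noteq> 0 \<Longrightarrow> (4::'a) \<noteq> 0"
  by (metis mult_2 mult_eq_0_iff numeral_Bit0)

definition entry :: "3 \<Rightarrow> 3 \<Rightarrow> ('a::field ^ 3) \<times> ('a ^ 3 \<Rightarrow> 'a ^ 3) \<Rightarrow> 'a" where
  "entry h k p = snd p (e k) $ h"

lemma entry_ebar: "entry h k (ebar h' k') = (if h = h' \<and> k = k' then 1 else 0)"
  by (simp add: entry_def ebar_eq e_nth)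

lemma entry_0: "entry h k 0 = 0"
  by (simp add: entry_def)

section \<open>Algebras with trivial Lie-center\<close>

text \<open>Lie-derivations take values in the Lie-center, so if that is zero, the second factor of the
  holomorph is trivial.\<close>

lemma (in leibniz_algebra) hol_Lie_iso_if_Z_Lie_trivial:
  assumes "Z_Lie A = {0}"
  shows "hol_Lie A \<cong>\<^sub>L A"
proof -
  interpret hol: leibniz_algebra "hol_Lie A"
    by (rule leibniz_algebra_hol_Lie)
  have "(0, 0) \<in> carr (hol_Lie A)"
    using hol.subspace_0[OF hol.carr_subspace] by (simp add: zero_prod_def)
  then have "0 \<in> Der_Lie A"
    by (simp add: hol_Lie_def)
  moreover have "d x = 0" if "d \<in> Der_Lie A" for d x
    using that assms by (cases "x \<in> carr A") (auto simp: Der_Lie_def Der_def)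
  ultimately have "Der_Lie A = {0}"
    by (auto simp: fun_eq_iff)
  then have carr: "carr (hol_Lie A) = carr A \<times> {0}"
    by (simp add: hol_Lie_def)
  have "linear_map (hol_Lie A) A fst"
    unfolding linear_map_def carr by (auto simp: hol_Lie_def)
  moreover have "bij_betw fst (carr (hol_Lie A)) (carr A)"
    unfolding carr by (auto simp: bij_betw_def inj_on_def)
  ultimately show ?thesis
    unfolding isomorphic_alg_def carr by (intro exI[of _ fst]) (auto simp: hol_Lie_def)
qed

section \<open>Testing on basis vectors\<close>

lemma brk_alg3_bilinear:
  "brk (alg3 T) (x + y) z = brk (alg3 T) x z + brk (alg3 T) y z"
  "brk (alg3 T) z (x + y) = brk (alg3 T) z x + brk (alg3 T) z y"
  "brk (alg3 T) (c *s x) z = c *s brk (alg3 T) x z"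
  "brk (alg3 T) z (c *s x) = c *s brk (alg3 T) z x"
  by (induction T; auto simp: algebra_simps)+

lemma Z_Lie_alg3_iff:
  "x \<in> Z_Lie (alg3 T) \<longleftrightarrow> (\<forall>j. brk (alg3 T) x (e j) + brk (alg3 T) (e j) x = 0)"
proof
  assume *: "\<forall>j. brk (alg3 T) x (e j) + brk (alg3 T) (e j) x = 0"
  have "brk (alg3 T) x y + brk (alg3 T) y x = 0" for y
  proof (induction y rule: basis_induct3)
    case (2 y z)
    have "brk (alg3 T) x (y + z) + brk (alg3 T) (y + z) x
        = (brk (alg3 T) x y + brk (alg3 T) y x) + (brk (alg3 T) x z + brk (alg3 T) z x)"
      by (simp only: brk_alg3_bilinear ac_simps)
    then show ?case
      by (simp only: 2 add_0)
  next
    case (3 c y)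
    then show ?case
      by (simp only: brk_alg3_bilinear vector_add_ldistrib[symmetric] vec.scale_zero_right)
  qed (use * in blast)
  then show "x \<in> Z_Lie (alg3 T)"
    by (simp add: Z_Lie_def)
qed (simp add: Z_Lie_def)

text \<open>By bilinearity both conditions on a Lie-derivation need only be tested on basis vectors, where
  they become finitely many linear equations for the entries \<open>d (e k) $ h\<close> of its matrix.\<close>

lemma Der_Lie_alg3_iff:
  fixes T :: "(3 \<times> 3 \<times> ('a::field ^ 3)) list"
  shows "d \<in> Der_Lie (alg3 T) \<longleftrightarrow> Vector_Spaces.linear (*s) (*s) d
    \<and> (\<forall>k. d (e k) \<in> Z_Lie (alg3 T))
    \<and> (\<forall>i j. d (brk (alg3 T) (e i) (e j))
        = brk (alg3 T) (d (e i)) (e j) + brk (alg3 T) (e i) (d (e j)))"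
    (is "_ \<longleftrightarrow> ?lin \<and> ?Z \<and> ?D")
proof
  show "?lin \<and> ?Z \<and> ?D" if "d \<in> Der_Lie (alg3 T)"
    using that
    by (auto simp: Der_Lie_def Der_def linear_map_def Vector_Spaces.linear_def module_hom_def
        module_hom_axioms_def vec.vector_space_axioms vec.module_axioms simp del: alg3_sel(3))
next
  assume *: "?lin \<and> ?Z \<and> ?D"
  then interpret Vector_Spaces.linear "(*s)" "(*s)" d
    by blast
  have "d x \<in> Z_Lie (alg3 T)" for x
  proof (induction x rule: basis_induct3)
    case (2 x y)
    have "brk (alg3 T) (d (x + y)) z + brk (alg3 T) z (d (x + y))
        = (brk (alg3 T) (d x) z + brk (alg3 T) z (d x))
          + (brk (alg3 T) (d y) z + brk (alg3 T) z (d y))" for z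
      by (simp only: brk_alg3_bilinear add ac_simps)
    then show ?case
      using 2 by (simp add: Z_Lie_def del: alg3_sel(3))
  next
    case (3 c x)
    then show ?case
      by (simp add: Z_Lie_def scale brk_alg3_bilinear vector_add_ldistrib[symmetric] del: alg3_sel(3))
  qed (use * in blast)
  moreover have "d (brk (alg3 T) x y) = brk (alg3 T) (d x) y + brk (alg3 T) x (d y)" for x y
  proof (induction x rule: basis_induct3)
    case (1 i)
    show ?case
      by (induction y rule: basis_induct3)
        (use * in \<open>auto simp: brk_alg3_bilinear add scale vector_add_ldistrib ac_simps simp del: alg3_sel(3)\<close>)
  qed (auto simp: brk_alg3_bilinear add scale vector_add_ldistrib ac_simps simp del: alg3_sel(3))
  ultimately show "d \<in> Der_Lie (alg3 T)"
    using add scale by (auto simp: Der_Lie_def Der_def linear_map_def simp del: alg3_sel(3))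
qed

lemma linear_simps:
  assumes "Vector_Spaces.linear (*s) (*s) (d :: 'a::field ^ 3 \<Rightarrow> 'a ^ 3)"
  shows "d (x + y) = d x + d y" "d (- x) = - d x" "d (c *s x) = c *s d x" "d 0 = 0"
  using assms by (auto simp: vec.linear_add vec.linear_neg vec.linear_scale vec.linear_0)

lemma Der_Lie_alg3_expand:
  assumes "d \<in> Der_Lie (alg3 T)"
  shows "d v = v $ 1 *s d (e 1) + v $ 2 *s d (e 2) + v $ 3 *s d (e 3)"
proof -
  interpret Vector_Spaces.linear "(*s)" "(*s)" d
    using assms by (simp only: Der_Lie_alg3_iff)
  have "d v = d (v $ 1 *s e 1 + v $ 2 *s e 2 + v $ 3 *s e 3)"
    using vec3_expand[of v] by simp
  also have "\<dots> = v $ 1 *s d (e 1) + v $ 2 *s d (e 2) + v $ 3 *s d (e 3)"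
    by (simp only: add scale)
  finally show ?thesis .
qed

section \<open>Lie-centers\<close>

lemmas L_defs = L1_def L2_def L3_def L4_def L5_def L6_def L7_def L8_def L9_def L10_def L11_def
  L12_def L13_def

text \<open>Each Lie-center is the radical of the symmetrised bracket. Its diagonal coefficients are twice
  those of the bracket, which is why 2 has to be invertible.\<close>

lemma Z_Lie_L:
  assumes "(2::'a::field) \<noteq> 0"
  shows "x \<in> Z_Lie (L1 :: ('a, 'a ^ 3) alg) \<longleftrightarrow> x = 0"
    and "x \<in> Z_Lie (L8 :: ('a, 'a ^ 3) alg) \<longleftrightarrow> x = 0"
    and "\<alpha> \<noteq> 0 \<Longrightarrow> x \<in> Z_Lie (L9 \<alpha> :: ('a, 'a ^ 3) alg) \<longleftrightarrow> x = 0"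
    and "\<alpha> \<noteq> 0 \<Longrightarrow> x \<in> Z_Lie (L10 \<alpha> :: ('a, 'a ^ 3) alg) \<longleftrightarrow> x = 0"
    and "x \<in> Z_Lie (L11 :: ('a, 'a ^ 3) alg) \<longleftrightarrow> x = 0"
    and "\<alpha> \<noteq> 0 \<Longrightarrow> x \<in> Z_Lie (L2 \<alpha> :: ('a, 'a ^ 3) alg) \<longleftrightarrow> x $ 1 = 0 \<and> x $ 3 = 0"
    and "x \<in> Z_Lie (L3 :: ('a, 'a ^ 3) alg) \<longleftrightarrow> x $ 3 = 0"
    and "x \<in> Z_Lie (L4 :: ('a, 'a ^ 3) alg) \<longleftrightarrow> x $ 2 = 0 \<and> x $ 3 = 0"
    and "\<alpha> \<noteq> 0 \<Longrightarrow> x \<in> Z_Lie (L5 \<alpha> :: ('a, 'a ^ 3) alg) \<longleftrightarrow> x $ 2 = 0 \<and> x $ 3 = 0"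
    and "x \<in> Z_Lie (L7 :: ('a, 'a ^ 3) alg) \<longleftrightarrow> x $ 2 = 0 \<and> x $ 3 = 0"
    and "x \<in> Z_Lie (L12 :: ('a, 'a ^ 3) alg) \<longleftrightarrow> x $ 1 = 0 \<and> x $ 3 = 0"
    and "x \<in> Z_Lie (L13 :: ('a, 'a ^ 3) alg) \<longleftrightarrow> x $ 1 = 0 \<and> x $ 3 = 0"
  using assms
  unfolding L_defs Z_Lie_alg3_iff forall_3
  by (auto simp: vec_eq_iff forall_3 e_nth mult_2[symmetric] add_eq_0_iff)

text \<open>Testing against \<open>e 2\<close> and \<open>e 3\<close> gives two equations in \<open>x $ 2\<close> and \<open>x $ 3\<close>;
  eliminating \<open>x $ 3\<close> leaves their determinant \<open>4 \<alpha> - 1\<close> as the coefficient of \<open>x $ 2\<close>.\<close>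

lemma Z_Lie_L6_iff:
  assumes "(2::'a::field) \<noteq> 0"
  shows "x \<in> Z_Lie (L6 \<alpha> :: ('a, 'a ^ 3) alg) \<longleftrightarrow> x $ 3 = - 2 * x $ 2 \<and> (4 * \<alpha> - 1) * x $ 2 = 0"
proof -
  have "x \<in> Z_Lie (L6 \<alpha> :: ('a, 'a ^ 3) alg) \<longleftrightarrow>
      2 * x $ 2 + x $ 3 = 0 \<and> x $ 2 + 2 * \<alpha> * x $ 3 = 0"
    unfolding L6_def Z_Lie_alg3_iff forall_3
    by (auto simp: vec_eq_iff forall_3 e_nth algebra_simps)
  also have "\<dots> \<longleftrightarrow> x $ 3 = - 2 * x $ 2 \<and> (4 * \<alpha> - 1) * x $ 2 = 0"
  proof -
    have "x $ 2 + 2 * \<alpha> * x $ 3 = - ((4 * \<alpha> - 1) * x $ 2)" if "x $ 3 = - 2 * x $ 2"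
      unfolding that by (simp add: algebra_simps)
    then show ?thesis
      by (auto simp: add_eq_0_iff)
  qed
  finally show ?thesis .
qed

section \<open>Lie-derivations\<close>

text \<open>The linear maps whose matrix has its non-zero entries at positions in \<open>P\<close> only: the span of
  the matrix units at these positions.\<close>

definition supported_on :: "(3 \<times> 3) set \<Rightarrow> ('a::field ^ 3 \<Rightarrow> 'a ^ 3) set" where
  "supported_on P = {d. Vector_Spaces.linear (*s) (*s) d
    \<and> (\<forall>h k. (h, k) \<notin> P \<longrightarrow> d (e k) $ h = 0)}"

lemma Der_Lie_alg3_eq_supported_on:
  assumes "\<And>d. Vector_Spaces.linear (*s) (*s) d \<Longrightarrow>
      (\<forall>k. d (e k) \<in> Z_Lie (alg3 T)) \<and> (\<forall>i j. d (brk (alg3 T) (e i) (e j))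
        = brk (alg3 T) (d (e i)) (e j) + brk (alg3 T) (e i) (d (e j)))
      \<longleftrightarrow> (\<forall>h k. (h, k) \<notin> P \<longrightarrow> d (e k) $ h = 0)"
  shows "Der_Lie (alg3 T) = supported_on P"
  using assms unfolding set_eq_iff Der_Lie_alg3_iff supported_on_def by blast

context
  assumes two: "(2::'a::field) \<noteq> 0"
begin

text \<open>The columns of \<open>d\<close> belonging to the span of the squares vanish, and so do the rows outside
  the Lie-center. Apart from \<open>L6 (1/4)\<close>, the derivation condition imposes nothing else, except
  on \<open>L3\<close>: there \<open>- d (e 2) = [d (e 2), e 3]\<close> has no component along \<open>e 1\<close>, which
  excludes the position \<open>(1, 2)\<close>.\<close>

lemma Der_Lie_L2:
  "\<alpha> \<noteq> 0 \<Longrightarrow> Der_Lie (L2 \<alpha> :: ('a, 'a ^ 3) alg) = supported_on {(2, 2), (2, 3)}"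
  unfolding L2_def using two
  by (intro Der_Lie_alg3_eq_supported_on)
    (auto simp: Z_Lie_L[OF two, unfolded L_defs] linear_simps forall_3 e_nth vec_eq_iff)

lemma Der_Lie_L3:
  "Der_Lie (L3 :: ('a, 'a ^ 3) alg) = supported_on {(1, 3), (2, 2), (2, 3)}"
  unfolding L3_def using two
  by (intro Der_Lie_alg3_eq_supported_on)
    (auto simp: Z_Lie_L[OF two, unfolded L_defs] linear_simps forall_3 e_nth vec_eq_iff)

lemma Der_Lie_L4:
  "Der_Lie (L4 :: ('a, 'a ^ 3) alg) = supported_on {(1, 2), (1, 3)}"
  unfolding L4_def using two
  by (intro Der_Lie_alg3_eq_supported_on)
    (auto simp: Z_Lie_L[OF two, unfolded L_defs] linear_simps forall_3 e_nth vec_eq_iff)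

lemma Der_Lie_L5:
  "\<alpha> \<noteq> 0 \<Longrightarrow> Der_Lie (L5 \<alpha> :: ('a, 'a ^ 3) alg) = supported_on {(1, 2), (1, 3)}"
  unfolding L5_def using two
  by (intro Der_Lie_alg3_eq_supported_on)
    (auto simp: Z_Lie_L[OF two, unfolded L_defs] linear_simps forall_3 e_nth vec_eq_iff)

lemma Der_Lie_L7:
  "Der_Lie (L7 :: ('a, 'a ^ 3) alg) = supported_on {(1, 2), (1, 3)}"
  unfolding L7_def using two
  by (intro Der_Lie_alg3_eq_supported_on)
    (auto simp: Z_Lie_L[OF two, unfolded L_defs] linear_simps forall_3 e_nth vec_eq_iff)

lemma Der_Lie_L12:
  "Der_Lie (L12 :: ('a, 'a ^ 3) alg) = supported_on {(2, 3)}"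
  unfolding L12_def using two
  by (intro Der_Lie_alg3_eq_supported_on)
    (auto simp: Z_Lie_L[OF two, unfolded L_defs] linear_simps forall_3 e_nth vec_eq_iff)

lemma Der_Lie_L13:
  "Der_Lie (L13 :: ('a, 'a ^ 3) alg) = supported_on {(2, 3)}"
  unfolding L13_def using two
  by (intro Der_Lie_alg3_eq_supported_on)
    (auto simp: Z_Lie_L[OF two, unfolded L_defs] linear_simps forall_3 e_nth vec_eq_iff)

lemma Der_Lie_L6:
  assumes "\<alpha> \<noteq> 1 / 4"
  shows "Der_Lie (L6 \<alpha> :: ('a, 'a ^ 3) alg) = supported_on {(1, 2), (1, 3)}"
proof -
  have "(4::'a) \<noteq> 0"
    by (rule four_neq_0[OF two])
  then have "4 * \<alpha> - 1 \<noteq> 0"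
    using assms by (auto simp: field_simps)
  then show ?thesis
    unfolding L6_def using two
    by (intro Der_Lie_alg3_eq_supported_on)
      (auto simp: Z_Lie_L6_iff[OF two, unfolded L6_def] linear_simps forall_3 e_nth vec_eq_iff)
qed

text \<open>At \<open>4 q = 1\<close> the Lie-center is spanned by \<open>e 1\<close> and \<open>e 2 - 2 e 3\<close>. The components
  along \<open>e 1\<close> of \<open>d (e 2)\<close> and \<open>d (e 3)\<close> are arbitrary, whereas \<open>[e 2, e 3] = e 1\<close> ties
  together their components along \<open>e 2 - 2 e 3\<close>, the second one being half of the first. The
  equations are stated without denominators so that they can be compared as polynomial identities
  modulo \<open>4 q = 1\<close>.\<close>

lemma Der_Lie_L6_quarter_iff:
  assumes q: "4 * q = 1"
  shows "d \<in> Der_Lie (L6 q :: ('a, 'a ^ 3) alg) \<longleftrightarrow> Vector_Spaces.linear (*s) (*s) d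
    \<and> d (e 1) = 0 \<and> d (e 2) $ 3 = - 2 * d (e 2) $ 2
    \<and> 2 * d (e 3) $ 2 = d (e 2) $ 2 \<and> d (e 3) $ 3 = - d (e 2) $ 2"
proof -
  have Z: "x \<in> Z_Lie (L6 q) \<longleftrightarrow> x $ 3 = - 2 * x $ 2" for x :: "'a ^ 3"
    using q by (simp add: Z_Lie_L6_iff[OF two])
  show ?thesis
    unfolding L6_def Der_Lie_alg3_iff using two
    by (intro conj_cong[OF refl])
      (auto simp: Z[unfolded L6_def] linear_simps forall_3 e_nth vec_eq_iff, (use q in algebra)+)
qed

end

section \<open>Bases of the holomorphs\<close>

text \<open>A family with a dual family of linear functionals is independent: if \<open>bs ! i\<close> were in the
  span of the others, then \<open>\<phi> i\<close>, which vanishes on them, would vanish on \<open>bs ! i\<close> too.\<close>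

lemma (in vector_space) dual_family_independent:
  fixes \<phi> :: "nat \<Rightarrow> 'b \<Rightarrow> 'a"
  assumes add: "\<And>i x y. \<phi> i (x + y) = \<phi> i x + \<phi> i y"
    and scl: "\<And>i c x. \<phi> i (scale c x) = c * \<phi> i x"
    and dual: "\<And>i j. i < length bs \<Longrightarrow> j < length bs \<Longrightarrow> \<phi> i (bs ! j) = (if i = j then 1 else 0)"
  shows "distinct bs" "independent (set bs)"
proof -
  show "distinct bs"
    unfolding distinct_conv_nth by (metis dual one_neq_zero)
  show "independent (set bs)"
  proof
    assume "dependent (set bs)"
    then obtain i where i: "i < length bs" "bs ! i \<in> span (set bs - {bs ! i})"
      by (auto simp: dependent_def in_set_conv_nth)
    have "subspace {x. \<phi> i x = 0}"
      using scl[of i 0 0] by (auto simp: subspace_def add scl)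
    moreover have "set bs - {bs ! i} \<subseteq> {x. \<phi> i x = 0}"
    proof
      fix x assume "x \<in> set bs - {bs ! i}"
      then obtain j where "j < length bs" "x = bs ! j" "j \<noteq> i"
        by (auto simp: in_set_conv_nth)
      then show "x \<in> {x. \<phi> i x = 0}"
        using dual[of i j] i by simp
    qed
    ultimately have "span (set bs - {bs ! i}) \<subseteq> {x. \<phi> i x = 0}"
      by (rule span_minimal[rotated])
    then show False
      using i dual[of i i] by auto
  qed
qed

text \<open>The functionals dual to \<open>etil 1\<close>, \<open>etil 2\<close>, \<open>etil 3\<close>, \<open>ds\<close> are the coordinates of the
  first component followed by the matrix entries at the positions \<open>pos\<close>. Thus a family \<open>ds\<close> of
  Lie-derivations need not consist of matrix units, as long as suitable entries tell its members
  apart.\<close>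

lemma hol_Lie_alg3_basis:
  fixes T :: "(3 \<times> 3 \<times> ('a::field ^ 3)) list"
  assumes L: "leibniz_algebra (alg3 T)"
    and len: "length pos = length ds"
    and mem: "\<And>d. d \<in> set ds \<Longrightarrow> fst d = 0 \<and> snd d \<in> Der_Lie (alg3 T)"
    and dual: "\<And>i j. i < length ds \<Longrightarrow> j < length ds \<Longrightarrow>
      case_prod entry (pos ! i) (ds ! j) = (if i = j then 1 else 0)"
    and expand: "\<And>d. d \<in> Der_Lie (alg3 T) \<Longrightarrow>
      (0, d) = (\<Sum>i<length ds. case_prod entry (pos ! i) (0, d) \<odot> ds ! i)"
    and bs: "bs = etil 1 # etil 2 # etil 3 # ds"
  shows "distinct bs" "\<not> module.dependent (scl (hol_Lie (alg3 T))) (set bs)"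
    "module.span (scl (hol_Lie (alg3 T))) (set bs) = carr (hol_Lie (alg3 T))"
proof -
  let ?H = "hol_Lie (alg3 T)"
  interpret H: leibniz_algebra ?H
    using L by (rule leibniz_algebra.leibniz_algebra_hol_Lie)
  have carr: "carr ?H = UNIV \<times> Der_Lie (alg3 T)"
    by (simp add: hol_Lie_def)
  have D0: "0 \<in> Der_Lie (alg3 T)"
    using H.subspace_0[OF H.carr_subspace] by (simp add: carr zero_prod_def)
  \<comment> \<open>The shift to \<open>Suc i\<close> runs through the coordinates 1, 2, 3 of the first component for
    \<open>i = 0, 1, 2\<close>; the index \<open>of_nat 3\<close> is \<open>3 = 0\<close> in the type \<open>3\<close>.\<close>
  define \<phi> :: "nat \<Rightarrow> ('a^3) \<times> ('a ^ 3 \<Rightarrow> 'a ^ 3) \<Rightarrow> 'a" where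
    "\<phi> i = (if i < 3 then (\<lambda>p. fst p $ (of_nat (Suc i))) else case_prod entry (pos ! (i - 3)))" for i
  have dual': "\<phi> i (bs ! j) = (if i = j then 1 else 0)" if "i < length bs" "j < length bs" for i j
  proof -
    have "i = 0 \<or> i = 1 \<or> i = 2 \<or> (\<exists>i'<length ds. i = Suc (Suc (Suc i')))"
      "j = 0 \<or> j = 1 \<or> j = 2 \<or> (\<exists>j'<length ds. j = Suc (Suc (Suc j')))"
      using that unfolding bs by (auto simp: less_Suc_eq_0_disj)
    then show ?thesis
      using dual mem[OF nth_mem]
      by (elim disjE exE conjE)
        (auto simp: \<phi>_def bs etil_def e_nth entry_def split: prod.splits)
  qed
  have add: "\<phi> i (x + y) = \<phi> i x + \<phi> i y" and scl: "\<phi> i (scl ?H c x) = c * \<phi> i x" for i c x y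
    by (auto simp: \<phi>_def entry_def scl_hol_Lie_alg3 scl_hol_def split: prod.splits)
  show "distinct bs" "\<not> H.dependent (set bs)"
    using H.dual_family_independent[of \<phi> bs, OF add scl dual'] by auto
  show "H.span (set bs) = carr ?H"
  proof
    have "set bs \<subseteq> carr ?H"
      using mem D0 by (fastforce simp: bs carr etil_def mem_Times_iff)
    then show "H.span (set bs) \<subseteq> carr ?H"
      by (rule H.span_minimal[OF _ H.carr_subspace])
    show "carr ?H \<subseteq> H.span (set bs)"
    proof
      fix p assume "p \<in> carr ?H"
      then obtain v d where p: "p = (v, d)" and d: "d \<in> Der_Lie (alg3 T)"
        by (auto simp: carr)
      have "p = (v $ 1 \<odot> etil 1 + v $ 2 \<odot> etil 2 + v $ 3 \<odot> etil 3) + (0, d)"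
        using vec3_expand[of v] by (simp add: p etil_def scl_hol_def fun_eq_iff prod_eq_iff)
      also have "\<dots> = (v $ 1 \<odot> etil 1 + v $ 2 \<odot> etil 2 + v $ 3 \<odot> etil 3)
          + (\<Sum>i<length ds. case_prod entry (pos ! i) (0, d) \<odot> ds ! i)"
        using expand[OF d] by simp
      also have "\<dots> \<in> H.span (set bs)"
        unfolding scl_hol_Lie_alg3[of T, symmetric]
        by (intro H.span_add H.span_sum H.span_scale H.span_base) (auto simp: bs)
      finally show "p \<in> H.span (set bs)" .
    qed
  qed
qed

text \<open>Matrix units at distinct positions are dual to the entries at these positions, and a matrix
  supported there is the combination of the units with its own entries as coefficients.\<close>

lemma hol_Lie_alg3_supported_basis:
  fixes T :: "(3 \<times> 3 \<times> ('a::field ^ 3)) list"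
  assumes L: "leibniz_algebra (alg3 T)" and Der: "Der_Lie (alg3 T) = supported_on (set pos)"
    and pos: "distinct pos"
    and bs: "bs = etil 1 # etil 2 # etil 3 # map (case_prod ebar) pos"
  shows "distinct bs" "\<not> module.dependent (scl (hol_Lie (alg3 T))) (set bs)"
    "module.span (scl (hol_Lie (alg3 T))) (set bs) = carr (hol_Lie (alg3 T))"
proof -
  let ?ds = "map (case_prod ebar) pos :: (('a ^ 3) \<times> ('a ^ 3 \<Rightarrow> 'a ^ 3)) list"
  have 1: "length pos = length ?ds"
    by simp
  have 2: "fst d = 0 \<and> snd d \<in> Der_Lie (alg3 T)" if "d \<in> set ?ds" for d
    using that unfolding Der supported_on_def ebar_eq
    by (auto simp: e_nth Vector_Spaces.linear_def module_hom_def
        module_hom_axioms_def vec.vector_space_axioms vec.module_axioms vec_eq_iff algebra_simps)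
  have 3: "case_prod entry (pos ! i) (?ds ! j) = (if i = j then 1 else 0)"
    if "i < length ?ds" "j < length ?ds" for i j
    using that nth_eq_iff_index_eq[OF pos, of i j]
    by (auto simp: entry_def ebar_eq e_nth split: prod.splits)
  have 4: "(0, d) = (\<Sum>i<length ?ds. case_prod entry (pos ! i) (0, d) \<odot> ?ds ! i)"
    if d: "d \<in> Der_Lie (alg3 T)" for d
  proof -
    have sum_eval: "fst (sum f A) = (\<Sum>x\<in>A. fst (f x)) \<and> snd (sum f A) v $ h = (\<Sum>x\<in>A. snd (f x) v $ h)"
      for f :: "3 \<times> 3 \<Rightarrow> ('a ^ 3) \<times> ('a ^ 3 \<Rightarrow> 'a ^ 3)" and A v h
      by (induction A rule: infinite_finite_induct) auto
    have d_eq: "d v $ h = (\<Sum>(h', k)\<in>set pos. d (e k) $ h' * (v $ k * e h' $ h))" for v h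
    proof -
      have "(\<Sum>(h', k)\<in>set pos. d (e k) $ h' * (v $ k * e h' $ h))
        = (\<Sum>(h', k)\<in>UNIV. d (e k) $ h' * (v $ k * e h' $ h))"
        using d by (intro sum.mono_neutral_left) (auto simp: Der supported_on_def)
      also have "\<dots> = (\<Sum>h'\<in>UNIV. \<Sum>k\<in>UNIV. d (e k) $ h' * (v $ k * e h' $ h))"
        by (simp add: sum.cartesian_product)
      also have "\<dots> = d v $ h"
        using exhaust_3[of h] Der_Lie_alg3_expand[OF d, of v] by (auto simp: sum_3 e_nth algebra_simps)
      finally show ?thesis ..
    qed
    have "(0, d) = (\<Sum>(h, k)\<in>set pos. entry h k (0, d) \<odot> ebar h k)" (is "_ = ?S")
    proof (intro prod_eqI ext)
      show "fst (0, d) = fst ?S"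
        by (simp add: sum_eval[THEN conjunct1] split_def scl_hol_def ebar_eq)
      have "snd ?S v $ h = (\<Sum>(h', k)\<in>set pos. d (e k) $ h' * (v $ k * e h' $ h))" for v h
        by (simp add: sum_eval[THEN conjunct2] split_def scl_hol_def ebar_eq entry_def mult.assoc)
      then show "snd (0, d) v = snd ?S v" for v
        by (simp add: vec_eq_iff d_eq[symmetric])
    qed
    also have "\<dots> = (\<Sum>i<length ?ds. case_prod entry (pos ! i) (0, d) \<odot> ?ds ! i)"
      using pos by (subst sum.distinct_set_conv_list) (auto simp: sum_list_sum_nth atLeast0LessThan split_def)
    finally show ?thesis .
  qed
  show "distinct bs" "\<not> module.dependent (scl (hol_Lie (alg3 T))) (set bs)"
    "module.span (scl (hol_Lie (alg3 T))) (set bs) = carr (hol_Lie (alg3 T))"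
    using hol_Lie_alg3_basis[OF L 1 2 3 4 bs] by blast+
qed

lemma has_basis_brackets_supported:
  assumes A: "A = alg3 T" and "leibniz_algebra A" "Der_Lie A = supported_on P"
    and "P = set pos" "distinct pos"
    and "bs = etil 1 # etil 2 # etil 3 # map (case_prod ebar) pos"
    and "\<forall>(u, v, w)\<in>B. u \<in> set bs \<and> v \<in> set bs \<and> brk (hol_Lie A) u v = w \<and> w \<noteq> 0"
    and "\<forall>u\<in>set bs. \<forall>v\<in>set bs. (\<nexists>w. (u, v, w) \<in> B) \<longrightarrow> brk (hol_Lie A) u v = 0"
  shows "has_basis_brackets (hol_Lie A) bs B"
  using hol_Lie_alg3_supported_basis[of T pos bs] assms
  unfolding has_basis_brackets_def by blast

text \<open>In this factorised form \<open>ebar0\<close> is visibly of rank one, with image spanned by the additional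
  Lie-central vector \<open>e 2 - 2 e 3\<close> of \<open>L6 (1/4)\<close>.\<close>

lemma ebar0_eq:
  assumes two: "(2::'a::field) \<noteq> 0"
  shows "(ebar0 :: ('a ^ 3) \<times> _) = (0, \<lambda>v. (v $ 2 + v $ 3 / 2) *s (e 2 - 2 *s e 3))"
  using two four_neq_0[OF two]
  by (auto simp: ebar0_def ebar_eq scl_hol_def fun_eq_iff vec_eq_iff e_nth forall_3 field_simps)

lemma hol_Lie_L6_quarter_basis:
  fixes bs :: "(('a::field ^ 3) \<times> _) list"
  assumes two: "(2::'a) \<noteq> 0"
    and bs: "bs = [etil 1, etil 2, etil 3, ebar0, ebar 1 2, ebar 1 3]"
  shows "distinct bs \<and> \<not> module.dependent (scl (hol_Lie (L6 (1/4) :: ('a, 'a ^ 3) alg))) (set bs)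
    \<and> module.span (scl (hol_Lie (L6 (1/4) :: ('a, 'a ^ 3) alg))) (set bs)
      = carr (hol_Lie (L6 (1/4) :: ('a, 'a ^ 3) alg))"
proof -
  let ?ds = "[ebar0, ebar 1 2, ebar 1 3] :: (('a ^ 3) \<times> _) list"
  let ?pos = "[(2, 2), (1, 2), (1, 3)] :: (3 \<times> 3) list"
  have four: "4 * (1/4) = (1::'a)"
    using four_neq_0[OF two] by simp
  note Der = Der_Lie_L6_quarter_iff[OF two four, unfolded L6_def]
  note L = leibniz_algebra_L(6)[of "1/4", unfolded L6_def]
  have 1: "length ?pos = length ?ds"
    by simp
  have 2: "fst d = 0 \<and> snd d \<in> Der_Lie (L6 (1/4))" if "d \<in> set ?ds" for d
    using that two four_neq_0[OF two]
    by (auto simp: Der L6_def ebar0_eq[OF two] ebar_eq e_nth Vector_Spaces.linear_def module_hom_def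
        module_hom_axioms_def vec.vector_space_axioms vec.module_axioms vec_eq_iff forall_3 field_simps)
  have 3: "case_prod entry (?pos ! i) (?ds ! j) = (if i = j then 1 else 0)"
    if "i < length ?ds" "j < length ?ds" for i j
    using that by (auto simp: less_Suc_eq entry_def ebar0_eq[OF two] ebar_eq e_nth)
  have 4: "(0, d) = (\<Sum>i<length ?ds. case_prod entry (?pos ! i) (0, d) \<odot> ?ds ! i)"
    if d: "d \<in> Der_Lie (L6 (1/4))" for d
  proof -
    let ?f = "\<lambda>v. d (e 2) $ 2 *s ((v $ 2 + v $ 3 / 2) *s (e 2 - 2 *s e 3))
      + d (e 2) $ 1 *s (v $ 2 *s e 1) + d (e 3) $ 1 *s (v $ 3 *s e 1)"
    have coeff: "d (e 1) = 0" "d (e 2) $ 3 = - 2 * d (e 2) $ 2" "d (e 3) $ 2 = d (e 2) $ 2 / 2"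
      "d (e 3) $ 3 = - d (e 2) $ 2"
      using d two by (auto simp: L6_def Der field_simps)
    have "d v = ?f v" for v
      using two four_neq_0[OF two]
      by (subst Der_Lie_alg3_expand[OF d[unfolded L6_def]])
        (auto simp: coeff e_nth vec_eq_iff forall_3 field_simps)
    then have "d = ?f"
      by (rule ext)
    then have "(0, d) = (0, ?f)"
      by (rule arg_cong)
    also have "\<dots> = (\<Sum>i<length ?ds. case_prod entry (?pos ! i) (0, d) \<odot> ?ds ! i)"
      by (simp add: ebar0_eq[OF two] ebar_eq entry_def scl_hol_def fun_eq_iff)
    finally show ?thesis .
  qed
  show ?thesis
    using hol_Lie_alg3_basis[OF L 1 2[unfolded L6_def] 3 4[unfolded L6_def] bs]
    unfolding L6_def by blast
qed

section \<open>Brackets of basis elements\<close>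

text \<open>Only the brackets of the \<open>etil j\<close> among themselves depend on the algebra; the others come from
  applying and multiplying matrix units.\<close>

lemma brk_hol_Lie_alg3:
  "brk (hol_Lie (alg3 T)) (etil i) (etil j) = (brk (alg3 T) (e i) (e j), 0)"
  "brk (hol_Lie (alg3 T)) (ebar h k) (etil j) = (if k = j then etil h else 0)"
  "brk (hol_Lie (alg3 T)) (etil j) (ebar h k) = (if k = j then - etil h else 0)"
  "brk (hol_Lie (alg3 T)) (ebar h k) (ebar h' k') =
    (if k = h' then ebar h k' else 0) - (if k' = h then ebar h' k else 0)"
proof -
  have 0: "brk (alg3 T) 0 x = 0" "brk (alg3 T) x 0 = 0" for x
    using brk_alg3_bilinear(3)[of T 0 0 x] brk_alg3_bilinear(4)[of T x 0 0]
    by (simp_all del: alg3_sel(3))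
  show "brk (hol_Lie (alg3 T)) (etil i) (etil j) = (brk (alg3 T) (e i) (e j), 0)"
    by (simp add: hol_Lie_def etil_def fun_eq_iff)
  show "brk (hol_Lie (alg3 T)) (ebar h k) (etil j) = (if k = j then etil h else 0)"
    by (simp add: hol_Lie_def etil_def ebar_eq fun_eq_iff e_nth 0 zero_prod_def del: alg3_sel(3))
  show "brk (hol_Lie (alg3 T)) (etil j) (ebar h k) = (if k = j then - etil h else 0)"
    by (simp add: hol_Lie_def etil_def ebar_eq fun_eq_iff e_nth 0 zero_prod_def del: alg3_sel(3))
  show "brk (hol_Lie (alg3 T)) (ebar h k) (ebar h' k') =
    (if k = h' then ebar h k' else 0) - (if k' = h then ebar h' k else 0)"
    by (auto simp: hol_Lie_def etil_def ebar_eq fun_eq_iff e_nth 0 zero_prod_def simp del: alg3_sel(3))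
qed

text \<open>A bracket table is a set of triples indexed by basis elements; deciding which pairs are listed
  and that the listed values are non-zero rests on these facts.\<close>

lemma etil_ebar_distinct:
  "etil i = etil j \<longleftrightarrow> i = j" "ebar h k = ebar h' k' \<longleftrightarrow> h = h' \<and> k = k'"
  "etil i \<noteq> ebar h k" "ebar h k \<noteq> etil i" "etil i \<noteq> 0" "ebar h k \<noteq> 0"
proof -
  show "etil i = etil j \<longleftrightarrow> i = j" "etil i \<noteq> ebar h k" "ebar h k \<noteq> etil i" "etil i \<noteq> 0"
    by (auto simp: etil_def ebar_def e_eq_iff e_neq_0 zero_prod_def)
  show "ebar h k \<noteq> 0"
    by (metis entry_ebar entry_0 zero_neq_one)
  show "ebar h k = ebar h' k' \<longleftrightarrow> h = h' \<and> k = k'"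
    using entry_ebar[of h k h k] entry_ebar[of h k h' k'] by (metis zero_neq_one)
qed

lemma scl_hol_eq_0_iff: "c \<odot> p = 0 \<longleftrightarrow> c = 0 \<or> p = 0"
  by (cases p) (auto simp: scl_hol_def zero_prod_def fun_eq_iff)

lemma etil_pair_simps:
  "(0, 0) = 0" "(e i, 0) = etil i" "(- e i, 0) = - etil i" "(c *s e i, 0) = c \<odot> etil i"
  "(e i + e j, 0) = etil i + etil j"
  by (auto simp: etil_def scl_hol_def zero_prod_def fun_eq_iff)

lemma brk_hol_Lie_ebar0:
  assumes two: "(2::'a::field) \<noteq> 0"
  shows "brk (hol_Lie (alg3 T)) ebar0 (etil 1) = (0 :: ('a ^ 3) \<times> _)"
    "brk (hol_Lie (alg3 T)) (etil 1) ebar0 = (0 :: ('a ^ 3) \<times> _)"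
    "brk (hol_Lie (alg3 T)) ebar0 (etil 2) = (etil 2 - 2 \<odot> etil 3 :: ('a ^ 3) \<times> _)"
    "brk (hol_Lie (alg3 T)) (etil 2) ebar0 = (- (etil 2 - 2 \<odot> etil 3) :: ('a ^ 3) \<times> _)"
    "brk (hol_Lie (alg3 T)) ebar0 (etil 3) = ((1/2) \<odot> (etil 2 - 2 \<odot> etil 3) :: ('a ^ 3) \<times> _)"
    "brk (hol_Lie (alg3 T)) (etil 3) ebar0 = (- ((1/2) \<odot> (etil 2 - 2 \<odot> etil 3)) :: ('a ^ 3) \<times> _)"
    "brk (hol_Lie (alg3 T)) ebar0 (ebar 1 2) = (- (ebar 1 2 + (1/2) \<odot> ebar 1 3) :: ('a ^ 3) \<times> _)"
    "brk (hol_Lie (alg3 T)) (ebar 1 2) ebar0 = (ebar 1 2 + (1/2) \<odot> ebar 1 3 :: ('a ^ 3) \<times> _)"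
    "brk (hol_Lie (alg3 T)) ebar0 (ebar 1 3) = (2 \<odot> ebar 1 2 + ebar 1 3 :: ('a ^ 3) \<times> _)"
    "brk (hol_Lie (alg3 T)) (ebar 1 3) ebar0 = (- (2 \<odot> ebar 1 2 + ebar 1 3) :: ('a ^ 3) \<times> _)"
    "brk (hol_Lie (alg3 T)) ebar0 ebar0 = (0 :: ('a ^ 3) \<times> _)"
  using brk_alg3_bilinear(3)[of T 0 0] brk_alg3_bilinear(4)[of T _ 0 0] two
  by (auto simp: hol_Lie_def ebar0_eq[OF two] ebar_eq etil_def scl_hol_def zero_prod_def fun_eq_iff
      vec_eq_iff e_nth forall_3 field_simps simp del: alg3_sel(3))

lemma ebar0_distinct:
  assumes two: "(2::'a::field) \<noteq> 0"
  shows "(ebar0 :: ('a ^ 3) \<times> _) \<noteq> etil i" "etil i \<noteq> (ebar0 :: ('a ^ 3) \<times> _)"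
    "(ebar0 :: ('a ^ 3) \<times> _) \<noteq> ebar 1 k" "ebar 1 k \<noteq> (ebar0 :: ('a ^ 3) \<times> _)"
    "etil 2 \<noteq> (2 \<odot> etil 3 :: ('a ^ 3) \<times> _)"
    "ebar 1 2 + (1/2) \<odot> ebar 1 3 \<noteq> (0 :: ('a ^ 3) \<times> _)"
    "2 \<odot> ebar 1 2 + ebar 1 3 \<noteq> (0 :: ('a ^ 3) \<times> _)"
proof -
  have 1: "entry 2 2 (ebar0 :: ('a ^ 3) \<times> _) = 1" "entry 2 2 (ebar 1 k :: ('a ^ 3) \<times> _) = 0"
    "entry 2 2 (etil i :: ('a ^ 3) \<times> _) = 0" for i k
    by (simp_all add: entry_def ebar0_eq[OF two] ebar_eq etil_def e_nth)
  show "(ebar0 :: ('a ^ 3) \<times> _) \<noteq> etil i" "etil i \<noteq> (ebar0 :: ('a ^ 3) \<times> _)"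
    "(ebar0 :: ('a ^ 3) \<times> _) \<noteq> ebar 1 k" "ebar 1 k \<noteq> (ebar0 :: ('a ^ 3) \<times> _)"
    using 1 by (metis one_neq_zero)+
  have "fst (etil 2 - 2 \<odot> etil 3 :: ('a ^ 3) \<times> _) $ 2 = 1"
    "entry 1 2 (ebar 1 2 + (1/2) \<odot> ebar 1 3 :: ('a ^ 3) \<times> _) = 1"
    "entry 1 3 (2 \<odot> ebar 1 2 + ebar 1 3 :: ('a ^ 3) \<times> _) = 1"
    by (simp_all add: entry_def ebar_eq etil_def e_nth scl_hol_def)
  then show "etil 2 \<noteq> (2 \<odot> etil 3 :: ('a ^ 3) \<times> _)"
    "ebar 1 2 + (1/2) \<odot> ebar 1 3 \<noteq> (0 :: ('a ^ 3) \<times> _)"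
    "2 \<odot> ebar 1 2 + ebar 1 3 \<noteq> (0 :: ('a ^ 3) \<times> _)"
    by (metis fst_zero right_minus_eq zero_index zero_neq_one, metis entry_0 zero_neq_one,
        metis entry_0 zero_neq_one)
qed

section \<open>The holomorphs\<close>

theorem theorem4p7:
  assumes "CHAR('a::field) \<noteq> 2"
  shows
    "(hol_Lie L1 \<cong>\<^sub>L (L1 :: ('a, 'a ^ 3) alg)
      \<and> hol_Lie L8 \<cong>\<^sub>L (L8 :: ('a, 'a ^ 3) alg)
      \<and> hol_Lie L11 \<cong>\<^sub>L (L11 :: ('a, 'a ^ 3) alg))
    \<and> (\<forall>\<alpha>::'a. \<alpha> \<noteq> 0 \<longrightarrow>
      has_basis_brackets (hol_Lie (L2 \<alpha>)) [etil 1, etil 2, etil 3, ebar 2 2, ebar 2 3]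
       {(etil 1, etil 3, \<alpha> \<odot> etil 1),
        (etil 3, etil 2, etil 2), (etil 2, etil 3, - etil 2),
        (ebar 2 2, ebar 2 3, ebar 2 3), (ebar 2 3, ebar 2 2, - ebar 2 3),
        (ebar 2 2, etil 2, etil 2), (etil 2, ebar 2 2, - etil 2),
        (ebar 2 3, etil 3, etil 2), (etil 3, ebar 2 3, - etil 2)})
    \<and> has_basis_brackets (hol_Lie (L3 :: ('a, 'a ^ 3) alg))
       [etil 1, etil 2, etil 3, ebar 1 3, ebar 2 2, ebar 2 3]
       {(etil 3, etil 2, etil 2), (etil 2, etil 3, - etil 2),
        (etil 3, etil 3, etil 1),
        (ebar 2 2, ebar 2 3, ebar 2 3), (ebar 2 3, ebar 2 2, - ebar 2 3),
        (ebar 1 3, etil 3, etil 1), (etil 3, ebar 1 3, - etil 1),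
        (ebar 2 2, etil 2, etil 2), (etil 2, ebar 2 2, - etil 2),
        (ebar 2 3, etil 3, etil 2), (etil 3, ebar 2 3, - etil 2)}
    \<and> has_basis_brackets (hol_Lie (L4 :: ('a, 'a ^ 3) alg))
       [etil 1, etil 2, etil 3, ebar 1 2, ebar 1 3]
       {(etil 2, etil 2, etil 1), (etil 3, etil 3, etil 1),
        (ebar 1 2, etil 2, etil 1), (etil 2, ebar 1 2, - etil 1),
        (ebar 1 3, etil 3, etil 1), (etil 3, ebar 1 3, - etil 1)}
    \<and> (\<forall>\<alpha>::'a. nontrivial_square_class \<alpha> \<longrightarrow>
      has_basis_brackets (hol_Lie (L5 \<alpha>)) [etil 1, etil 2, etil 3, ebar 1 2, ebar 1 3]
       {(etil 2, etil 2, etil 1), (etil 3, etil 3, \<alpha> \<odot> etil 1),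
        (ebar 1 2, etil 2, etil 1), (etil 2, ebar 1 2, - etil 1),
        (ebar 1 3, etil 3, etil 1), (etil 3, ebar 1 3, - etil 1)})
    \<and> (\<forall>\<alpha>::'a. \<alpha> \<noteq> 0 \<and> \<alpha> \<noteq> 1/4 \<longrightarrow>
      has_basis_brackets (hol_Lie (L6 \<alpha>)) [etil 1, etil 2, etil 3, ebar 1 2, ebar 1 3]
       {(etil 2, etil 2, etil 1), (etil 2, etil 3, etil 1), (etil 3, etil 3, \<alpha> \<odot> etil 1),
        (ebar 1 2, etil 2, etil 1), (etil 2, ebar 1 2, - etil 1),
        (ebar 1 3, etil 3, etil 1), (etil 3, ebar 1 3, - etil 1)})
    \<and> has_basis_brackets (hol_Lie (L6 (1/4 :: 'a)))
       [etil 1, etil 2, etil 3, ebar0, ebar 1 2, ebar 1 3]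
       {(etil 2, etil 2, etil 1), (etil 2, etil 3, etil 1), (etil 3, etil 3, (1/4) \<odot> etil 1),
        (ebar 1 2, ebar0, ebar 1 2 + (1/2) \<odot> ebar 1 3),
        (ebar0, ebar 1 2, - (ebar 1 2 + (1/2) \<odot> ebar 1 3)),
        (ebar0, ebar 1 3, 2 \<odot> ebar 1 2 + ebar 1 3),
        (ebar 1 3, ebar0, - (2 \<odot> ebar 1 2 + ebar 1 3)),
        (ebar0, etil 2, etil 2 - 2 \<odot> etil 3),
        (etil 2, ebar0, - (etil 2 - 2 \<odot> etil 3)),
        (ebar0, etil 3, (1/2) \<odot> (etil 2 - 2 \<odot> etil 3)),
        (etil 3, ebar0, - ((1/2) \<odot> (etil 2 - 2 \<odot> etil 3))),
        (ebar 1 2, etil 2, etil 1), (etil 2, ebar 1 2, - etil 1),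
        (ebar 1 3, etil 3, etil 1), (etil 3, ebar 1 3, - etil 1)}
    \<and> has_basis_brackets (hol_Lie (L7 :: ('a, 'a ^ 3) alg))
       [etil 1, etil 2, etil 3, ebar 1 2, ebar 1 3]
       {(etil 2, etil 3, etil 1),
        (ebar 1 2, etil 2, etil 1), (etil 2, ebar 1 2, - etil 1),
        (ebar 1 3, etil 3, etil 1), (etil 3, ebar 1 3, - etil 1)}
    \<and> (\<forall>\<alpha>::'a. nontrivial_square_class \<alpha> \<longrightarrow> hol_Lie (L9 \<alpha>) \<cong>\<^sub>L L9 \<alpha>)
    \<and> (\<forall>\<alpha>::'a. \<alpha> \<noteq> 0 \<longrightarrow> hol_Lie (L10 \<alpha>) \<cong>\<^sub>L L10 \<alpha>)
    \<and> has_basis_brackets (hol_Lie (L12 :: ('a, 'a ^ 3) alg))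
       [etil 1, etil 2, etil 3, ebar 2 3]
       {(etil 1, etil 3, etil 2), (etil 3, etil 3, etil 1),
        (ebar 2 3, etil 3, etil 2), (etil 3, ebar 2 3, - etil 2)}
    \<and> has_basis_brackets (hol_Lie (L13 :: ('a, 'a ^ 3) alg))
       [etil 1, etil 2, etil 3, ebar 2 3]
       {(etil 1, etil 3, etil 1 + etil 2), (etil 3, etil 3, etil 1),
        (ebar 2 3, etil 3, etil 2), (etil 3, ebar 2 3, - etil 2)}"
proof -
  have two: "(2::'a) \<noteq> 0"
  proof
    assume "(2::'a) = 0"
    then have "CHAR('a) dvd 2"
      using of_nat_eq_0_iff_char_dvd[where 'a = 'a, of 2] by simp
    then have "CHAR('a) = 1 \<or> CHAR('a) = 2"
      using two_is_prime_nat prime_nat_iff by blast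
    then show False
      using assms by simp
  qed
  note trivial = leibniz_algebra.hol_Lie_iso_if_Z_Lie_trivial set_eqI
  note table = brk_hol_Lie_alg3 etil_ebar_distinct scl_hol_eq_0_iff etil_pair_simps e_nth
  note basis = has_basis_brackets_supported
  \<comment> \<open>In the cases with a bracket table, the values \<open>w\<close> are pairs; splitting the bound \<open>w\<close> in
    \<open>\<nexists>w. (u, v, w) \<in> T\<close> would hide that one of them is named by the table.\<close>
  show ?thesis
  proof (intro conjI allI impI, goal_cases)
    case 1 show ?case
      by (intro trivial leibniz_algebra_L) (simp add: Z_Lie_L[OF two])
  next
    case 2 show ?case
      by (intro trivial leibniz_algebra_L) (simp add: Z_Lie_L[OF two])
  next
    case 3 show ?case
      by (intro trivial leibniz_algebra_L) (simp add: Z_Lie_L[OF two])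
  next
    case (4 \<alpha>) then show ?case
      by (intro basis[OF L2_def leibniz_algebra_L(2) Der_Lie_L2[OF two], where pos = "[(2, 2), (2, 3)]"])
        (simp_all add: table L2_def del: split_paired_Ex split_paired_All)
  next
    case 5 show ?case
      by (intro basis[OF L3_def leibniz_algebra_L(3) Der_Lie_L3[OF two], where pos = "[(1, 3), (2, 2), (2, 3)]"])
        (simp_all add: table L3_def del: split_paired_Ex split_paired_All)
  next
    case 6 show ?case
      by (intro basis[OF L4_def leibniz_algebra_L(4) Der_Lie_L4[OF two], where pos = "[(1, 2), (1, 3)]"])
        (simp_all add: table L4_def del: split_paired_Ex split_paired_All)
  next
    case (7 \<alpha>) then have "\<alpha> \<noteq> 0" by (simp add: nontrivial_square_class_def)
    then show ?case
      by (intro basis[OF L5_def leibniz_algebra_L(5) Der_Lie_L5[OF two], where pos = "[(1, 2), (1, 3)]"])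
        (simp_all add: table L5_def del: split_paired_Ex split_paired_All)
  next
    case (8 \<alpha>) then show ?case
      by (intro basis[OF L6_def leibniz_algebra_L(6) Der_Lie_L6[OF two], where pos = "[(1, 2), (1, 3)]"])
        (simp_all add: table L6_def del: split_paired_Ex split_paired_All)
  next
    case 9
    \<comment> \<open>The table lists \<open>- (u + v)\<close> unexpanded, and so must the simplifier leave it.\<close>
    show ?case
      using hol_Lie_L6_quarter_basis[OF two refl] four_neq_0[OF two] two unfolding has_basis_brackets_def
      by (simp add: table L6_def brk_hol_Lie_ebar0[OF two] ebar0_distinct[OF two]
        del: split_paired_Ex split_paired_All minus_add_distrib minus_diff_eq)
  next
    case 10 show ?case
      by (intro basis[OF L7_def leibniz_algebra_L(7) Der_Lie_L7[OF two], where pos = "[(1, 2), (1, 3)]"])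
        (simp_all add: table L7_def del: split_paired_Ex split_paired_All)
  next
    case (11 \<alpha>) then have "\<alpha> \<noteq> 0" by (simp add: nontrivial_square_class_def)
    then show ?case
      by (intro trivial leibniz_algebra_L) (simp add: Z_Lie_L[OF two])
  next
    case (12 \<alpha>) then show ?case
      by (intro trivial leibniz_algebra_L) (simp add: Z_Lie_L[OF two])
  next
    case 13 show ?case
      by (intro basis[OF L12_def leibniz_algebra_L(12) Der_Lie_L12[OF two], where pos = "[(2, 3)]"])
        (simp_all add: table L12_def del: split_paired_Ex split_paired_All)
  next
    case 14
    have "etil 1 + etil 2 \<noteq> (0 :: ('a ^ 3) \<times> _)"
      by (auto simp: etil_def zero_prod_def vec_eq_iff e_nth forall_3)
    then show ?case
      by (intro basis[OF L13_def leibniz_algebra_L(13) Der_Lie_L13[OF two], where pos = "[(2, 3)]"])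
        (simp_all add: table L13_def del: split_paired_Ex split_paired_All)
  qed
qed

end
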